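(* Let $g:\mathbb{C}\times\mathbb{C}\to\mathbb{C}$ be antisymmetric, $g(x,y)=-g(y,x)$, and let $f:\mathbb{C}\times\mathbb{C}\to\mathbb{C}$ belong to $\mathrm{Ker}\,\mathcal{L}^{(g)}_3$. Let $F$ be a function of one complex variable and let $\{x_i\}$, $\{b_i\}$ be sequences of complex numbers (the nodes $b_i$ pairwise distinct) such that no denominator occurring below vanishes. Then for any integer $n\ge 0$, $$\mathbb{D}^{(n+1)}_{(f,g)}\left[\begin{matrix}b_0,b_1,\dots,b_{n+1}\\ x_1,\dots,x_n\end{matrix}\right]\{F(x)\}=\frac{f(x_n,b_0)}{g(b_{n+1},b_0)}\,\mathbb{D}^{(n)}_{(f,g)}\left[\begin{matrix}b_0,b_1,\dots,b_n\\ x_1,\dots,x_{n-1}\end{matrix}\right]\{F(x)\}+\frac{f(x_n,b_{n+1})}{g(b_0,b_{n+1})}\,\mathbb{D}^{(n)}_{(f,g)}\left[\begin{matrix}b_1,b_2,\dots,b_{n+1}\\ x_1,\dots,x_{n-1}\end{matrix}\right]\{F(x)\}.$$ In particular, if $f(x,y)=1$ belongs to $\mathrm{Ker}\,\mathcal{L}^{(g)}_3$, then, writing $\mathbb{D}^{(n)}_{(g)}[b_0,\dots,b_n]$ for the operator with $f=1$, $$\mathbb{D}^{(n+1)}_{(g)}[b_0,b_1,\dots,b_{n+1}]\{F(x)\}=\frac{\mathbb{D}^{(n)}_{(g)}[b_0,b_1,\dots,b_n]\{F(x)\}-\mathbb{D}^{(n)}_{(g)}[b_1,b_2,\dots,b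_{n+1}]\{F(x)\}}{g(b_{n+1},b_0)}.$$
   Context: For antisymmetric $g$, $\mathrm{Ker}\,\mathcal{L}^{(g)}_3$ is the set of functions $f(x,y)$ of two complex variables such that for all $a,b,c,x\in\mathbb{C}$: $f(x,a)g(b,c)+f(x,b)g(c,a)+f(x,c)g(a,b)=0$. The $(f,g)$-difference operator of order $m\ge 0$ with nodes $b_r,\dots,b_{r+m}$ and parameters $x_{s+1},\dots,x_{s+m-1}$ is $$\mathbb{D}^{(m)}_{(f,g)}\left[\begin{matrix}b_r,b_{r+1},\dots,b_{r+m}\\ x_{s+1},\dots,x_{s+m-1}\end{matrix}\right]\{F(x)\}=\sum_{k=r}^{r+m}F(b_k)\frac{\prod_{i=s+1}^{s+m-1}f(x_i,b_k)}{\prod_{i=r,\,i\ne k}^{r+m}g(b_i,b_k)}.$$ For $m=1$ the numerator product is empty (equal to $1$). For $m=0$, by the convention $\prod_{i=s+1}^{s-1}A_i=1/A_s$, the value is $F(b_r)/f(x_s,b_r)$. In the theorem $s=0$ for all operators. *)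

theory Defs
  imports Complex_Main
begin

definition Ker_L3 :: "(complex \<Rightarrow> complex \<Rightarrow> complex) \<Rightarrow> (complex \<Rightarrow> complex \<Rightarrow> complex) set" where
  "Ker_L3 g = {f. \<forall>a b c x. f x a * g b c + f x b * g c a + f x c * g a b = 0}"

text \<open>The product of \<open>A i\<close> for \<open>i\<close> from \<open>s + 1\<close> to \<open>s + m - 1\<close>, where for \<open>m = 0\<close> the
  convention is that the product from \<open>s + 1\<close> to \<open>s - 1\<close> equals \<open>1 / A s\<close>.\<close>

definition param_prod :: "nat \<Rightarrow> nat \<Rightarrow> (nat \<Rightarrow> complex) \<Rightarrow> complex" where
  "param_prod s m A = (if m = 0 then 1 / A s else (\<Prod>i = s + 1..s + m - 1. A i))"

text \<open>The operator of order \<open>m\<close> with nodes \<open>b r, \<dots>, b (r + m)\<close> and parameters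
  \<open>x (s + 1), \<dots>, x (s + m - 1)\<close>; for \<open>m = 0\<close> the parameter \<open>x s\<close> is used.\<close>

definition fg_diff ::
  "(complex \<Rightarrow> complex \<Rightarrow> complex) \<Rightarrow> (complex \<Rightarrow> complex \<Rightarrow> complex) \<Rightarrow> nat \<Rightarrow>
   nat \<Rightarrow> (nat \<Rightarrow> complex) \<Rightarrow> nat \<Rightarrow> (nat \<Rightarrow> complex) \<Rightarrow> (complex \<Rightarrow> complex) \<Rightarrow> complex" where
  "fg_diff f g m r b s x F =
     (\<Sum>k = r..r + m. F (b k) * param_prod s m (\<lambda>i. f (x i) (b k)) /
        (\<Prod>i \<in> {r..r + m} - {k}. g (b i) (b k)))"

text \<open>For \<open>f = 1\<close> the parameters do not matter (see \<open>fg_diff_one\<close>), so they are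
  fixed arbitrarily.\<close>

definition g_diff ::
  "(complex \<Rightarrow> complex \<Rightarrow> complex) \<Rightarrow> nat \<Rightarrow>
   nat \<Rightarrow> (nat \<Rightarrow> complex) \<Rightarrow> (complex \<Rightarrow> complex) \<Rightarrow> complex" where
  "g_diff g m r b F = fg_diff (\<lambda>_ _. 1) g m r b 0 (\<lambda>_. 0) F"

lemma fg_diff_one: "fg_diff (\<lambda>_ _. 1) g m r b s x F = g_diff g m r b F"
  by (simp add: g_diff_def fg_diff_def param_prod_def)

end

theory Submission
  imports Defs
begin

text \<open>
  Both operators of order \<open>n\<close> on the right-hand side live on one fewer node than the operator on
  the left. The idea is to write all three as sums over the full node set, with the same
  denominators \<open>w k = (\<Prod>i\<noteq>k. g (b i) (b k))\<close>. Adjoining a node \<open>b j\<close> to an operator costs a factor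
  \<open>g (b j) (b k)\<close> in the \<open>k\<close>-th numerator, and the extra summand \<open>k = j\<close> is harmless because
  antisymmetry gives \<open>g (b j) (b j) = 0\<close> (\<open>sum_adjoin_node\<close>). The recurrence then holds summand
  by summand: with \<open>N = n + 1\<close> and the common factor removed, the \<open>k\<close>-th one reads
  \<open>f (x n) (b k) = f (x n) (b 0) * g (b N) (b k) / g (b N) (b 0) + f (x n) (b N) * g (b 0) (b k) / g (b 0) (b N)\<close>,
  which is the defining three-term relation of \<open>Ker_L3 g\<close> at the points \<open>b k, b N, b 0\<close>
  (\<open>Ker_L3_interpolation\<close>); it says that \<open>f (x n)\<close> is determined by its values at two points,
  as for linear interpolation.
\<close>

lemma antisym_diag_zero:
  fixes g :: "'a \<Rightarrow> 'a \<Rightarrow> complex"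
  assumes "\<forall>u v. g u v = - g v u"
  shows "g u u = 0"
proof -
  have "g u u = - g u u"
    using assms by blast
  then show ?thesis
    by simp
qed

lemma Ker_L3_interpolation:
  assumes "f \<in> Ker_L3 g" and antisym: "\<forall>u v. g u v = - g v u" and "g p q \<noteq> 0"
  shows "f y z = f y q * g p z / g p q + f y p * g q z / g q p"
proof -
  have "f y z * g p q + f y p * g q z + f y q * g z p = 0"
    using assms(1) unfolding Ker_L3_def by blast
  moreover have "g z p = - g p z" "g q p = - g p q"
    using antisym by blast+
  ultimately show ?thesis
    using \<open>g p q \<noteq> 0\<close> by (simp add: divide_simps) (simp add: algebra_simps eq_neg_iff_add_eq_0)
qed

text \<open>For \<open>m = 0\<close> the convention \<open>param_prod s 0 A = 1 / A s\<close> is exactly what continues the product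
  recursion downwards, provided that \<open>A s\<close> can be cancelled.\<close>

lemma param_prod_Suc:
  assumes "m = 0 \<longrightarrow> A s \<noteq> 0"
  shows "param_prod s (Suc m) A = param_prod s m A * A (s + m)"
proof (cases m)
  case 0
  then show ?thesis
    using assms by (simp add: param_prod_def)
next
  case (Suc l)
  then show ?thesis
    by (simp add: param_prod_def)
qed

text \<open>Adjoining the node \<open>j\<close> multiplies the \<open>k\<close>-th denominator by \<open>g (b j) (b k)\<close>, which the new
  numerator cancels; the new summand \<open>k = j\<close> vanishes since its numerator contains
  \<open>g (b j) (b j)\<close>.\<close>

lemma sum_adjoin_node:
  fixes g :: "'a \<Rightarrow> 'a \<Rightarrow> complex"
  assumes "finite S" "j \<notin> S" "g (b j) (b j) = 0" "\<And>k. k \<in> S \<Longrightarrow> g (b j) (b k) \<noteq> 0"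
  shows "(\<Sum>k\<in>S. h k / (\<Prod>i\<in>S - {k}. g (b i) (b k))) =
    (\<Sum>k\<in>insert j S. h k * g (b j) (b k) / (\<Prod>i\<in>insert j S - {k}. g (b i) (b k)))"
proof -
  have "h k / (\<Prod>i\<in>S - {k}. g (b i) (b k)) =
      h k * g (b j) (b k) / (\<Prod>i\<in>insert j S - {k}. g (b i) (b k))" if "k \<in> S" for k
  proof -
    have "insert j S - {k} = insert j (S - {k})"
      using that \<open>j \<notin> S\<close> by auto
    then show ?thesis
      using assms that by simp
  qed
  then show ?thesis
    using assms by (simp cong: sum.cong)
qed

theorem fg_diff_recurrence:
  assumes antisym: "\<forall>u v. g u v = - g v u"
    and g_nonzero: "\<forall>i \<in> {0..n + 1}. \<forall>j \<in> {0..n + 1}. i \<noteq> j \<longrightarrow> g (b i) (b j) \<noteq> 0"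
    and ker: "f \<in> Ker_L3 g"
    and f_nonzero: "n = 0 \<longrightarrow> f (x 0) (b 0) \<noteq> 0 \<and> f (x 0) (b 1) \<noteq> 0"
  shows "fg_diff f g (n + 1) 0 b 0 x F =
    f (x n) (b 0) / g (b (n + 1)) (b 0) * fg_diff f g n 0 b 0 x F +
    f (x n) (b (n + 1)) / g (b 0) (b (n + 1)) * fg_diff f g n 1 b 0 x F"
proof -
  define N where "N = n + 1"
  define h where "h k = F (b k) * param_prod 0 n (\<lambda>i. f (x i) (b k))" for k
  define w where "w k = (\<Prod>i\<in>{0..N} - {k}. g (b i) (b k))" for k
  have nodes: "insert N {0..n} = {0..N}" "insert 0 {1..N} = {0..N}"
    by (auto simp: N_def)
  have left: "fg_diff f g n 0 b 0 x F = (\<Sum>k\<in>{0..N}. h k * g (b N) (b k) / w k)"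
    using sum_adjoin_node[of "{0..n}" N g b h] antisym_diag_zero[OF antisym] g_nonzero
    unfolding nodes by (simp add: fg_diff_def h_def w_def N_def)
  have right: "fg_diff f g n 1 b 0 x F = (\<Sum>k\<in>{0..N}. h k * g (b 0) (b k) / w k)"
    using sum_adjoin_node[of "{1..N}" 0 g b h] antisym_diag_zero[OF antisym] g_nonzero
    unfolding nodes by (simp add: fg_diff_def h_def w_def N_def)
  have "g (b N) (b 0) \<noteq> 0"
    using g_nonzero by (simp add: N_def)
  note interpolation = Ker_L3_interpolation[OF ker antisym this]
  have pointwise: "F (b k) * param_prod 0 N (\<lambda>i. f (x i) (b k)) / w k =
      f (x n) (b 0) / g (b N) (b 0) * (h k * g (b N) (b k) / w k) +
      f (x n) (b N) / g (b 0) (b N) * (h k * g (b 0) (b k) / w k)" if "k \<in> {0..N}" for k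
  proof -
    have "n = 0 \<longrightarrow> f (x 0) (b k) \<noteq> 0"
      using f_nonzero that by (auto simp: N_def le_Suc_eq)
    then have "F (b k) * param_prod 0 N (\<lambda>i. f (x i) (b k)) = h k * f (x n) (b k)"
      using param_prod_Suc[of n "\<lambda>i. f (x i) (b k)" 0] by (simp add: N_def h_def)
    also have "\<dots> = h k * (f (x n) (b 0) * g (b N) (b k) / g (b N) (b 0) +
        f (x n) (b N) * g (b 0) (b k) / g (b 0) (b N))"
      using interpolation[of "x n" "b k"] by simp
    finally show ?thesis
      by (simp add: add_divide_distrib distrib_left mult_ac)
  qed
  have "fg_diff f g N 0 b 0 x F =
      (\<Sum>k\<in>{0..N}. F (b k) * param_prod 0 N (\<lambda>i. f (x i) (b k)) / w k)"
    by (simp add: fg_diff_def w_def)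
  also have "\<dots> = f (x n) (b 0) / g (b N) (b 0) * fg_diff f g n 0 b 0 x F +
      f (x n) (b N) / g (b 0) (b N) * fg_diff f g n 1 b 0 x F"
    unfolding left right sum_distrib_left sum.distrib[symmetric]
    by (rule sum.cong[OF refl pointwise])
  finally show ?thesis
    by (simp add: N_def)
qed

theorem theorem2p1:
  fixes f g :: "complex \<Rightarrow> complex \<Rightarrow> complex"
    and F :: "complex \<Rightarrow> complex"
    and x b :: "nat \<Rightarrow> complex"
    and n :: nat
  assumes antisym: "\<forall>u v. g u v = - g v u"
    and distinct_nodes: "inj_on b {0..n + 1}"
    and g_nonzero: "\<forall>i \<in> {0..n + 1}. \<forall>j \<in> {0..n + 1}. i \<noteq> j \<longrightarrow> g (b i) (b j) \<noteq> 0"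
  shows "(f \<in> Ker_L3 g \<and> (n = 0 \<longrightarrow> f (x 0) (b 0) \<noteq> 0 \<and> f (x 0) (b 1) \<noteq> 0) \<longrightarrow>
            fg_diff f g (n + 1) 0 b 0 x F =
              f (x n) (b 0) / g (b (n + 1)) (b 0) * fg_diff f g n 0 b 0 x F +
              f (x n) (b (n + 1)) / g (b 0) (b (n + 1)) * fg_diff f g n 1 b 0 x F) \<and>
         ((\<lambda>_ _. 1) \<in> Ker_L3 g \<longrightarrow>
            g_diff g (n + 1) 0 b F =
              (g_diff g n 0 b F - g_diff g n 1 b F) / g (b (n + 1)) (b 0))"
proof (intro conjI impI)
  assume "f \<in> Ker_L3 g \<and> (n = 0 \<longrightarrow> f (x 0) (b 0) \<noteq> 0 \<and> f (x 0) (b 1) \<noteq> 0)"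
  then show "fg_diff f g (n + 1) 0 b 0 x F =
      f (x n) (b 0) / g (b (n + 1)) (b 0) * fg_diff f g n 0 b 0 x F +
      f (x n) (b (n + 1)) / g (b 0) (b (n + 1)) * fg_diff f g n 1 b 0 x F"
    using fg_diff_recurrence[OF antisym g_nonzero] by blast
next
  assume "(\<lambda>_ _. 1) \<in> Ker_L3 g"
  then have "g_diff g (n + 1) 0 b F =
      1 / g (b (n + 1)) (b 0) * g_diff g n 0 b F + 1 / g (b 0) (b (n + 1)) * g_diff g n 1 b F"
    using fg_diff_recurrence[OF antisym g_nonzero, where f = "\<lambda>_ _. 1"] by (simp add: fg_diff_one)
  moreover have "g (b 0) (b (n + 1)) = - g (b (n + 1)) (b 0)"
    using antisym by blast
  ultimately show "g_diff g (n + 1) 0 b F =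
      (g_diff g n 0 b F - g_diff g n 1 b F) / g (b (n + 1)) (b 0)"
    by (simp add: diff_divide_distrib)
qed

end
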